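(* Let $i:G\hookrightarrow H$ be the inclusion of the group $G$ of origin-preserving symplectomorphisms of $D$ into $H=\mathrm{Symp}(D)$, and let $\tau:G\to\mathbb{R}$ be the $1$-cochain $\tau(g)=\int_\gamma (g^*\eta-\eta)$. Then, with $x_0=(1,0)$, the pullback of the ILM cocycle to $G$ satisfies $$-\delta\tau = i^*C_{\eta,x_0}\in C^2(G;\mathbb{R}).$$
   Context: $D=\{(x,y)\in\mathbb{R}^2 \mid x^2+y^2\le 1\}$ has symplectic form $\omega = dx\wedge dy$, and $\eta=(x\,dy-y\,dx)/2$, so $d\eta=\omega$. $H=\mathrm{Symp}(D)=\{g\in\mathrm{Diff}(D)\mid g^*\omega=\omega\}$ and $G=\{g\in H\mid g(0,0)=(0,0)\}$. The path $\gamma:[0,1]\to D$ is $\gamma(t)=(t,0)$. The ILM (Ismagilov–Losik–Michor) cocycle is $$C_{\eta,x_0}(g,h)=\int_{x_0}^{h(x_0)}(g^*\eta-\eta),\qquad g,h\in H,$$ the integral being along any path in $D$ from $x_0$ to $h(x_0)$. For a $1$-cochain $\tau:G\to\mathbb{R}$ (trivial coefficients), $\delta\tau(g,h)=\tau(h)-\tau(gh)+\tau(g)$. *)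

theory Defs
  imports "HOL-Analysis.Analysis" "HOL-Algebra.Bij"
begin

section \<open>Smooth maps\<close>

primrec C_k_on :: "nat \<Rightarrow> ('a::euclidean_space \<Rightarrow> 'b::euclidean_space) \<Rightarrow> 'a set \<Rightarrow> bool" where
  "C_k_on 0 f U \<longleftrightarrow> continuous_on U f"
| "C_k_on (Suc n) f U \<longleftrightarrow>
     (\<forall>x\<in>U. f differentiable (at x)) \<and> (\<forall>v. C_k_on n (\<lambda>x. frechet_derivative f (at x) v) U)"

text \<open>Smoothness on an arbitrary subset (here: a closed disc, including its boundary) means
  that the map extends, near every point of the subset, to a smooth map on an open set.\<close>

definition smooth_on :: "'a::euclidean_space set \<Rightarrow> ('a \<Rightarrow> 'b::euclidean_space) \<Rightarrow> bool" where
  "smooth_on S f \<longleftrightarrow>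
     (\<forall>x\<in>S. \<exists>U F. open U \<and> x \<in> U \<and> (\<forall>n. C_k_on n F U) \<and> (\<forall>y\<in>S \<inter> U. F y = f y))"

text \<open>Self-maps of \<open>S\<close> are extensional functions, as in \<^const>\<open>BijGroup\<close>.\<close>

definition Diff :: "'a::euclidean_space set \<Rightarrow> ('a \<Rightarrow> 'a) set" where
  "Diff S = {g \<in> Bij S. smooth_on S g \<and> smooth_on S (inv_into S g)}"

section \<open>Differential forms and line integrals\<close>

text \<open>A 1-form sends a point and a tangent vector to a real, a 2-form a point and two tangent
  vectors.  The derivative in a pullback is taken within \<open>S\<close>, since the maps are only
  meaningful there; it is unique for the disc, see \<open>disc_derivative_unique\<close> below.\<close>

type_synonym 'a one_form = "'a \<Rightarrow> 'a \<Rightarrow> real"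
type_synonym 'a two_form = "'a \<Rightarrow> 'a \<Rightarrow> 'a \<Rightarrow> real"

definition pullback1 ::
    "'a::euclidean_space set \<Rightarrow> ('a \<Rightarrow> 'a) \<Rightarrow> 'a one_form \<Rightarrow> 'a one_form" where
  "pullback1 S g \<alpha> = (\<lambda>p v. \<alpha> (g p) (frechet_derivative g (at p within S) v))"

definition pullback2 ::
    "'a::euclidean_space set \<Rightarrow> ('a \<Rightarrow> 'a) \<Rightarrow> 'a two_form \<Rightarrow> 'a two_form" where
  "pullback2 S g \<beta> = (\<lambda>p u v. \<beta> (g p) (frechet_derivative g (at p within S) u)
                                       (frechet_derivative g (at p within S) v))"

definition has_line_integral ::
    "'a::euclidean_space one_form \<Rightarrow> real \<Rightarrow> (real \<Rightarrow> 'a) \<Rightarrow> bool" where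
  "has_line_integral \<alpha> c p \<longleftrightarrow>
     ((\<lambda>t. \<alpha> (p t) (vector_derivative p (at t within {0..1}))) has_integral c) {0..1}"

definition line_integral :: "(real \<Rightarrow> 'a::euclidean_space) \<Rightarrow> 'a one_form \<Rightarrow> real" where
  "line_integral p \<alpha> =
     integral {0..1} (\<lambda>t. \<alpha> (p t) (vector_derivative p (at t within {0..1})))"

section \<open>The disc and its symplectomorphism groups\<close>

definition disc :: "(real \<times> real) set" where
  "disc = {(x, y). x\<^sup>2 + y\<^sup>2 \<le> 1}"

definition omega :: "(real \<times> real) two_form" where
  "omega = (\<lambda>p u v. fst u * snd v - snd u * fst v)"

definition eta :: "(real \<times> real) one_form" where
  "eta = (\<lambda>p v. (fst p * snd v - snd p * fst v) / 2)"

definition gamma :: "real \<Rightarrow> real \<times> real" where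
  "gamma t = (t, 0)"

definition Symp :: "((real \<times> real) \<Rightarrow> (real \<times> real)) monoid" where
  "Symp = (BijGroup disc)
     \<lparr>carrier := {g \<in> Diff disc. \<forall>p\<in>disc. pullback2 disc g omega p = omega p}\<rparr>"

definition Symp0 :: "((real \<times> real) \<Rightarrow> (real \<times> real)) monoid" where
  "Symp0 = Symp\<lparr>carrier := {g \<in> carrier Symp. g (0, 0) = (0, 0)}\<rparr>"

section \<open>Group cochains with trivial real coefficients\<close>

text \<open>A cochain of a group with carrier \<open>G\<close> is a function on powers of \<open>G\<close>; its value
  on arguments outside of \<open>G\<close> is fixed to be 0, so that equality and the pointwise
  operations on functions are those of cochains.\<close>

definition cochains1 :: "'g monoid \<Rightarrow> ('g \<Rightarrow> real) set" where
  "cochains1 G = {c. \<forall>g. g \<notin> carrier G \<longrightarrow> c g = 0}"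

definition cochains2 :: "'g monoid \<Rightarrow> ('g \<Rightarrow> 'g \<Rightarrow> real) set" where
  "cochains2 G = {c. \<forall>g h. \<not> (g \<in> carrier G \<and> h \<in> carrier G) \<longrightarrow> c g h = 0}"

definition coboundary1 :: "'g monoid \<Rightarrow> ('g \<Rightarrow> real) \<Rightarrow> 'g \<Rightarrow> 'g \<Rightarrow> real" where
  "coboundary1 G c = (\<lambda>g h. if g \<in> carrier G \<and> h \<in> carrier G
     then c h - c (g \<otimes>\<^bsub>G\<^esub> h) + c g else 0)"

definition cochain_pullback2 ::
    "'g monoid \<Rightarrow> ('g \<Rightarrow> 'h) \<Rightarrow> ('h \<Rightarrow> 'h \<Rightarrow> real) \<Rightarrow> 'g \<Rightarrow> 'g \<Rightarrow> real" where
  "cochain_pullback2 G f c = (\<lambda>g h. if g \<in> carrier G \<and> h \<in> carrier G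
     then c (f g) (f h) else 0)"

text \<open>The definite description encodes that the integral may be taken along any (piecewise
  continuously differentiable) path in the disc from \<open>x0\<close> to \<open>h x0\<close>: it denotes the common
  value of all these integrals, and is meaningful only because they agree.\<close>

definition ILM_cocycle ::
    "(real \<times> real) one_form \<Rightarrow> real \<times> real \<Rightarrow>
     ((real \<times> real) \<Rightarrow> (real \<times> real)) \<Rightarrow> ((real \<times> real) \<Rightarrow> (real \<times> real)) \<Rightarrow> real" where
  "ILM_cocycle \<alpha> x0 = (\<lambda>g h. if g \<in> carrier Symp \<and> h \<in> carrier Symp
     then THE c. \<forall>p. valid_path p \<and> path_image p \<subseteq> disc \<and> pathstart p = x0 \<and> pathfinish p = h x0
                   \<longrightarrow> has_line_integral (pullback1 disc g \<alpha> - \<alpha>) c p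
     else 0)"

definition tau :: "((real \<times> real) \<Rightarrow> (real \<times> real)) \<Rightarrow> real" where
  "tau g = (if g \<in> carrier Symp0 then line_integral gamma (pullback1 disc g eta - eta) else 0)"

section \<open>\<open>Symp\<close> and \<open>Symp0\<close> are groups\<close>

lemma C_k_on_cong:
  assumes "open U" "\<And>x. x \<in> U \<Longrightarrow> f x = g x" "C_k_on n f U"
  shows "C_k_on n g U"
  using assms(2,3)
proof (induction n arbitrary: f g)
  case 0
  then show ?case by (simp cong: continuous_on_cong)
next
  case (Suc n)
  have d: "(g has_derivative frechet_derivative f (at x)) (at x)" if "x \<in> U" for x
    using Suc.prems that assms(1)
    by (metis C_k_on.simps(2) frechet_derivative_works has_derivative_transform_within_open)
  then have "frechet_derivative g (at x) = frechet_derivative f (at x)" if "x \<in> U" for x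
    using that frechet_derivative_at by metis
  then have "C_k_on n (\<lambda>x. frechet_derivative g (at x) v) U" for v
    using Suc.IH[of "\<lambda>x. frechet_derivative f (at x) v" "\<lambda>x. frechet_derivative g (at x) v"]
      Suc.prems by auto
  then show ?case using d unfolding C_k_on.simps differentiable_def by blast
qed

lemma C_k_on_SucI:
  assumes "open U" "\<And>x. x \<in> U \<Longrightarrow> (f has_derivative D x) (at x)" "\<And>v. C_k_on n (\<lambda>x. D x v) U"
  shows "C_k_on (Suc n) f U"
proof -
  have "D x = frechet_derivative f (at x)" if "x \<in> U" for x
    using assms(2)[OF that] frechet_derivative_at by blast
  then have "C_k_on n (\<lambda>x. frechet_derivative f (at x) v) U" for v
    using C_k_on_cong[OF assms(1) _ assms(3)[of v]] by simp
  then show ?thesis using assms(2) unfolding C_k_on.simps differentiable_def by blast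
qed

lemma C_k_on_SucD:
  assumes "C_k_on (Suc n) f U" "x \<in> U"
  shows "(f has_derivative frechet_derivative f (at x)) (at x)"
  using assms frechet_derivative_works by auto

lemma C_k_on_Suc_imp: "C_k_on (Suc n) f U \<Longrightarrow> C_k_on n f U"
proof (induction n arbitrary: f)
  case 0
  then show ?case
    by (auto intro!: continuous_at_imp_continuous_on differentiable_imp_continuous_within)
next
  case (Suc n)
  then show ?case by (metis C_k_on.simps(2))
qed

lemma C_k_on_subset: "C_k_on n f U \<Longrightarrow> V \<subseteq> U \<Longrightarrow> C_k_on n f V"
  by (induction n arbitrary: f) (auto intro: continuous_on_subset)

lemma C_k_on_const: "open U \<Longrightarrow> C_k_on n (\<lambda>x. c) U"
  by (induction n arbitrary: c) auto

lemma C_k_on_id: "open U \<Longrightarrow> C_k_on n (\<lambda>x. x) U"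
  by (cases n) (auto simp: C_k_on_const)

lemma C_k_on_add:
  assumes "open U" "C_k_on n f U" "C_k_on n g U"
  shows "C_k_on n (\<lambda>x. f x + g x) U"
  using assms(2,3)
proof (induction n arbitrary: f g)
  case 0
  then show ?case by (simp add: continuous_on_add)
next
  case (Suc n)
  show ?case
    by (rule C_k_on_SucI[OF assms(1),
          where D = "\<lambda>x v. frechet_derivative f (at x) v + frechet_derivative g (at x) v"])
       (use Suc C_k_on_SucD in \<open>auto intro!: has_derivative_add simp del: C_k_on.simps\<close>,
        use Suc in auto)
qed

lemma C_k_on_sum:
  assumes "open U" "\<And>i. i \<in> I \<Longrightarrow> C_k_on n (f i) U"
  shows "C_k_on n (\<lambda>x. \<Sum>i\<in>I. f i x) U"
  using assms(2)
proof (induction I rule: infinite_finite_induct)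
  case (insert i I)
  then show ?case by (simp add: C_k_on_add[OF assms(1)])
qed (simp_all add: C_k_on_const[OF assms(1)])

lemma C_k_on_inner:
  assumes "open U" "C_k_on n f U"
  shows "C_k_on n (\<lambda>x. f x \<bullet> b) U"
  using assms(2)
proof (induction n arbitrary: f)
  case 0
  then show ?case by (auto intro!: continuous_intros)
next
  case (Suc n)
  show ?case
    by (rule C_k_on_SucI[OF assms(1), where D = "\<lambda>x v. frechet_derivative f (at x) v \<bullet> b"])
       (use Suc C_k_on_SucD in \<open>auto intro!: has_derivative_inner_left simp del: C_k_on.simps\<close>,
        use Suc in auto)
qed

lemma C_k_on_scaleR:
  fixes a :: "'a::euclidean_space \<Rightarrow> real"
  assumes "open U" "C_k_on n a U" "C_k_on n f U"
  shows "C_k_on n (\<lambda>x. a x *\<^sub>R f x) U"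
  using assms(2,3)
proof (induction n arbitrary: a f)
  case 0
  then show ?case by (auto intro!: continuous_intros)
next
  case (Suc n)
  have "((\<lambda>x. a x *\<^sub>R f x) has_derivative
      (\<lambda>v. a x *\<^sub>R frechet_derivative f (at x) v + frechet_derivative a (at x) v *\<^sub>R f x)) (at x)"
    if "x \<in> U" for x
    by (intro has_derivative_scaleR C_k_on_SucD[OF Suc.prems(1) that]
        C_k_on_SucD[OF Suc.prems(2) that])
  moreover have "C_k_on n (\<lambda>x. a x *\<^sub>R frechet_derivative f (at x) v
      + frechet_derivative a (at x) v *\<^sub>R f x) U" for v
    using Suc.prems C_k_on_Suc_imp[OF Suc.prems(1)] C_k_on_Suc_imp[OF Suc.prems(2)]
    by (intro C_k_on_add[OF assms(1)] Suc.IH) auto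
  ultimately show ?case
    by (rule C_k_on_SucI[OF assms(1)])
qed

lemma C_k_on_compose:
  assumes "open U" "open V" "C_k_on n f V" "C_k_on n g U" "g ` U \<subseteq> V"
  shows "C_k_on n (\<lambda>x. f (g x)) U"
  using assms(3-5)
proof (induction n arbitrary: f g)
  case 0
  then show ?case by (auto intro: continuous_on_compose2)
next
  case (Suc n)
  let ?f = "\<lambda>x. frechet_derivative f (at x)" and ?g = "\<lambda>x. frechet_derivative g (at x)"
  have d: "((\<lambda>x. f (g x)) has_derivative (\<lambda>v. \<Sum>b\<in>Basis. (?g x v \<bullet> b) *\<^sub>R ?f (g x) b)) (at x)"
    if x: "x \<in> U" for x
  proof -
    have g: "(g has_derivative ?g x) (at x)" and f: "(f has_derivative ?f (g x)) (at (g x))"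
      using C_k_on_SucD Suc.prems x by blast+
    have lin: "linear (?f (g x))"
      using f has_derivative_linear by blast
    have "(\<lambda>v. ?f (g x) (?g x v)) = (\<lambda>v. \<Sum>b\<in>Basis. (?g x v \<bullet> b) *\<^sub>R ?f (g x) b)"
    proof
      fix v
      let ?w = "?g x v"
      have "?f (g x) ?w = ?f (g x) (\<Sum>b\<in>Basis. (?w \<bullet> b) *\<^sub>R b)"
        by (simp only: euclidean_representation)
      also have "\<dots> = (\<Sum>b\<in>Basis. (?w \<bullet> b) *\<^sub>R ?f (g x) b)"
        by (simp only: linear_sum[OF lin] linear_scale[OF lin])
      finally show "?f (g x) ?w = (\<Sum>b\<in>Basis. (?w \<bullet> b) *\<^sub>R ?f (g x) b)" .
    qed
    with has_derivative_compose[OF g f] show ?thesis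
      by (simp only:)
  qed
  have "C_k_on n g U" using Suc.prems C_k_on_Suc_imp by blast
  then have f: "C_k_on n (\<lambda>x. ?f (g x) b) U" for b
    using Suc.prems by (intro Suc.IH[of "\<lambda>y. ?f y b"]) simp_all
  have g: "C_k_on n (\<lambda>x. ?g x v) U" for v
    using Suc.prems(2) by simp
  have "C_k_on n (\<lambda>x. \<Sum>b\<in>Basis. (?g x v \<bullet> b) *\<^sub>R ?f (g x) b) U" for v
    by (intro C_k_on_sum[OF assms(1)] C_k_on_scaleR[OF assms(1)] C_k_on_inner[OF assms(1)] f g)
  with d show ?case
    by (rule C_k_on_SucI[OF assms(1)])
qed

lemma smooth_on_cong:
  assumes "smooth_on S f" "\<And>x. x \<in> S \<Longrightarrow> f x = g x"
  shows "smooth_on S g"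
  unfolding smooth_on_def
proof
  fix x assume "x \<in> S"
  then obtain U F where "open U" "x \<in> U" "\<forall>n. C_k_on n F U" "\<forall>y\<in>S \<inter> U. F y = f y"
    using assms(1) unfolding smooth_on_def by blast
  then show "\<exists>U F. open U \<and> x \<in> U \<and> (\<forall>n. C_k_on n F U) \<and> (\<forall>y\<in>S \<inter> U. F y = g y)"
    using assms(2) by (intro exI[of _ U] exI[of _ F]) simp
qed

lemma smooth_on_id: "smooth_on S (\<lambda>x. x)"
  unfolding smooth_on_def using C_k_on_id[OF open_UNIV] by blast

lemma smooth_on_compose:
  assumes "smooth_on S f" "smooth_on S g" "g ` S \<subseteq> S"
  shows "smooth_on S (\<lambda>x. f (g x))"
  unfolding smooth_on_def
proof
  fix x assume x: "x \<in> S"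
  obtain U G where U: "open U" "x \<in> U" "\<And>n. C_k_on n G U" "\<And>y. y \<in> S \<inter> U \<Longrightarrow> G y = g y"
    using assms(2) x unfolding smooth_on_def by metis
  have "g x \<in> S" using assms(3) x by auto
  then obtain V F where V: "open V" "g x \<in> V" "\<And>n. C_k_on n F V" "\<And>y. y \<in> S \<inter> V \<Longrightarrow> F y = f y"
    using assms(1) unfolding smooth_on_def by metis
  let ?W = "U \<inter> G -` V"
  have "continuous_on U G" using U(3)[of 0] by simp
  then have o: "open ?W" using U(1) V(1) continuous_open_preimage by blast
  have "C_k_on n (\<lambda>x. F (G x)) ?W" for n
    by (rule C_k_on_compose[OF o V(1) V(3)]) (auto intro: C_k_on_subset[OF U(3)])
  moreover have "x \<in> ?W" using U V x by auto
  moreover have "F (G y) = f (g y)" if "y \<in> S \<inter> ?W" for y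
    using U(4)[of y] V(4)[of "g y"] that assms(3) by auto
  ultimately show "\<exists>U F. open U \<and> x \<in> U \<and> (\<forall>n. C_k_on n F U) \<and> (\<forall>y\<in>S \<inter> U. F y = f (g y))"
    using o by blast
qed

lemma smooth_on_has_derivative:
  assumes "smooth_on S f" "x \<in> S"
  shows "(f has_derivative frechet_derivative f (at x within S)) (at x within S)"
proof -
  obtain U F where U: "open U" "x \<in> U" "\<forall>n. C_k_on n F U" "\<forall>y\<in>S \<inter> U. F y = f y"
    using assms unfolding smooth_on_def by blast
  have "(F has_derivative frechet_derivative F (at x)) (at x within S)"
    by (rule has_derivative_at_withinI[OF C_k_on_SucD[OF U(3)[rule_format] U(2)]])
  moreover have "\<forall>\<^sub>F y in at x within S. F y = f y"
    unfolding eventually_at_topological using U(1,2,4) by (intro exI[of _ U]) auto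
  ultimately have d: "(f has_derivative frechet_derivative F (at x)) (at x within S)"
    by (rule has_derivative_transform_eventually) (use U(2,4) assms(2) in auto)
  show ?thesis
    by (rule frechet_derivative_works[THEN iffD1, OF differentiableI[OF d]])
qed

lemma disc_cball: "disc = cball 0 1"
  by (auto simp: disc_def norm_Pair)

lemma disc_derivative_unique:
  fixes f :: "real \<times> real \<Rightarrow> 'b::euclidean_space"
  assumes A: "(f has_derivative A) (at p within disc)" and B: "(f has_derivative B) (at p within disc)"
    and p: "p \<in> disc"
  shows "A = B"
proof -
  have lin: "linear A" "linear B" using A B has_derivative_linear by auto
  have dir: "A (q - p) = B (q - p)" if q: "q \<in> disc" for q
  proof -
    let ?l = "\<lambda>t::real. p + t *\<^sub>R (q - p)"
    have l: "(?l has_vector_derivative (q - p)) (at 0 within {0..1})"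
      by (auto intro!: derivative_eq_intros)
    have im: "?l ` {0..1} \<subseteq> disc"
    proof
      fix z assume "z \<in> ?l ` {0..1}"
      then obtain t where t: "0 \<le> t" "t \<le> 1" "z = ?l t" by auto
      then have "z = (1 - t) *\<^sub>R p + t *\<^sub>R q" by (simp add: algebra_simps)
      then show "z \<in> disc"
        using t p q convexD[OF convex_cball, of p 0 1 q "1 - t" t] by (simp add: disc_cball)
    qed
    have *: "((f \<circ> ?l) has_vector_derivative L (q - p)) (at 0 within {0..1})"
      if "(f has_derivative L) (at p within disc)" for L
    proof -
      have "(f has_derivative L) (at (?l 0) within ?l ` {0..1})"
        using has_derivative_subset[OF that im] by simp
      then have "((f \<circ> ?l) has_derivative L \<circ> (\<lambda>t. t *\<^sub>R (q - p))) (at 0 within {0..1})"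
        using diff_chain_within l unfolding has_vector_derivative_def by blast
      then show ?thesis
        using linear_scale[OF has_derivative_linear[OF that]]
        by (simp add: has_vector_derivative_def o_def)
    qed
    show ?thesis
      by (rule vector_derivative_unique_within[OF _ *[OF A] *[OF B]])
         (simp add: trivial_limit_within islimpt_Icc)
  qed
  have "A p = B p"
    using dir[of 0] lin by (simp add: disc_cball linear_neg)
  then have eq: "A q = B q" if "q \<in> disc" for q
    using dir[OF that] lin by (simp add: linear_diff)
  show "A = B"
  proof
    fix v :: "real \<times> real"
    have v: "v = fst v *\<^sub>R (1, 0) + snd v *\<^sub>R (0, 1)" by (simp add: prod_eq_iff)
    have "A (1, 0) = B (1, 0)" "A (0, 1) = B (0, 1)" by (simp_all add: eq disc_def)
    then show "A v = B v"
      by (subst (1 2) v) (simp only: linear_add[OF lin(1)] linear_add[OF lin(2)]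
        linear_scale[OF lin(1)] linear_scale[OF lin(2)])
  qed
qed

lemma disc_derivative_compose:
  assumes "smooth_on disc f" "smooth_on disc g" "g ` disc \<subseteq> disc" "p \<in> disc"
    "\<And>x. x \<in> disc \<Longrightarrow> k x = f (g x)"
  shows "frechet_derivative k (at p within disc) v =
    frechet_derivative f (at (g p) within disc) (frechet_derivative g (at p within disc) v)"
proof -
  let ?f = "frechet_derivative f (at (g p) within disc)"
  let ?g = "frechet_derivative g (at p within disc)"
  have "(f has_derivative ?f) (at (g p) within g ` disc)"
    using smooth_on_has_derivative[OF assms(1)] assms(3,4) has_derivative_subset by blast
  then have "((f \<circ> g) has_derivative ?f \<circ> ?g) (at p within disc)"
    using smooth_on_has_derivative[OF assms(2,4)] diff_chain_within by blast
  then have k: "(k has_derivative ?f \<circ> ?g) (at p within disc)"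
    by (rule has_derivative_transform[OF assms(4), rotated]) (simp add: assms(5))
  have "frechet_derivative k (at p within disc) = ?f \<circ> ?g"
    by (rule disc_derivative_unique[OF frechet_derivative_works[THEN iffD1, OF differentiableI[OF k]]
          k assms(4)])
  then show ?thesis by simp
qed

lemma disc_derivative_id:
  assumes "p \<in> disc" "\<And>x. x \<in> disc \<Longrightarrow> k x = x"
  shows "frechet_derivative k (at p within disc) v = v"
proof -
  have k: "(k has_derivative (\<lambda>v. v)) (at p within disc)"
    by (rule has_derivative_transform[OF assms(1) _ has_derivative_ident]) (simp add: assms(2))
  have "frechet_derivative k (at p within disc) = (\<lambda>v. v)"
    by (rule disc_derivative_unique[OF frechet_derivative_works[THEN iffD1, OF differentiableI[OF k]]
          k assms(1)])
  then show ?thesis by simp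
qed

lemma Diff_disc_mem: "g \<in> Diff disc \<Longrightarrow> p \<in> disc \<Longrightarrow> g p \<in> disc"
  by (auto simp: Diff_def dest: Bij_imp_funcset)

lemma Symp_subgroup: "subgroup (carrier Symp) (BijGroup disc)"
proof (rule group.subgroupI[OF group_BijGroup])
  show "carrier Symp \<subseteq> carrier (BijGroup disc)"
    by (auto simp: Symp_def Diff_def BijGroup_def)
  have "(\<lambda>x\<in>disc. x) \<in> carrier Symp"
  proof -
    have bij: "(\<lambda>x\<in>disc. x) \<in> Bij disc" by (rule id_Bij)
    have "inv_into disc (\<lambda>x\<in>disc. x) x = x" if "x \<in> disc" for x
      using bij that by (intro inv_into_f_eq) (auto simp: Bij_def bij_betw_def)
    then have "(\<lambda>x\<in>disc. x) \<in> Diff disc"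
      using bij by (auto simp: Diff_def intro: smooth_on_cong[OF smooth_on_id])
    then show ?thesis
      by (auto simp: Symp_def pullback2_def omega_def disc_derivative_id)
  qed
  then show "carrier Symp \<noteq> {}" by blast
next
  fix g assume "g \<in> carrier Symp"
  then have g: "g \<in> Diff disc" and s: "\<And>p. p \<in> disc \<Longrightarrow> pullback2 disc g omega p = omega p"
    by (auto simp: Symp_def)
  have bij: "g \<in> Bij disc" and sm: "smooth_on disc g" "smooth_on disc (inv_into disc g)"
    using g by (auto simp: Diff_def)
  let ?k = "\<lambda>x\<in>disc. inv_into disc g x"
  have kB: "?k \<in> Bij disc" using bij by (rule restrict_inv_into_Bij)
  have gk: "g (?k x) = x" if "x \<in> disc" for x
    using bij that by (simp add: Bij_def bij_betw_def f_inv_into_f)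
  have kim: "?k ` disc \<subseteq> disc" using kB Bij_imp_funcset by blast
  have ks: "smooth_on disc ?k" by (rule smooth_on_cong[OF sm(2)]) simp
  have "inv_into disc ?k x = g x" if "x \<in> disc" for x
  proof (rule inv_into_f_eq)
    show "inj_on ?k disc" using kB by (simp add: Bij_def bij_betw_def)
    show "g x \<in> disc" using Diff_disc_mem[OF g that] .
    then show "?k (g x) = x" using bij that by (simp add: Bij_def bij_betw_def)
  qed
  then have "?k \<in> Diff disc"
    using kB ks sm(1) by (auto simp: Diff_def intro: smooth_on_cong)
  moreover have "pullback2 disc ?k omega p = omega p" if p: "p \<in> disc" for p
  proof (intro ext)
    fix u v
    let ?D = "frechet_derivative ?k (at p within disc)"
    have kp: "?k p \<in> disc" using kim p by blast
    have D: "frechet_derivative g (at (?k p) within disc) (?D w) = w" for w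
      using disc_derivative_compose[OF sm(1) ks kim p, of "\<lambda>x. g (?k x)" w]
        disc_derivative_id[OF p, of "\<lambda>x. g (?k x)" w] gk by simp
    have "pullback2 disc ?k omega p u v = omega (?k p) (?D u) (?D v)"
      by (simp add: pullback2_def)
    also have "\<dots> = pullback2 disc g omega (?k p) (?D u) (?D v)"
      using s[OF kp] by simp
    also have "\<dots> = omega p u v"
      using D by (simp add: pullback2_def omega_def del: restrict_apply)
    finally show "pullback2 disc ?k omega p u v = omega p u v" .
  qed
  ultimately have "?k \<in> carrier Symp" by (simp add: Symp_def)
  then show "inv\<^bsub>BijGroup disc\<^esub> g \<in> carrier Symp"
    using bij by (simp add: inv_BijGroup)
next
  fix g h assume "g \<in> carrier Symp" "h \<in> carrier Symp"
  then have g: "g \<in> Diff disc" and h: "h \<in> Diff disc"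
    and sg: "\<And>p. p \<in> disc \<Longrightarrow> pullback2 disc g omega p = omega p"
    and sh: "\<And>p. p \<in> disc \<Longrightarrow> pullback2 disc h omega p = omega p"
    by (auto simp: Symp_def)
  have B: "g \<in> Bij disc" "h \<in> Bij disc" and sm: "smooth_on disc g" "smooth_on disc h"
    and smi: "smooth_on disc (inv_into disc g)" "smooth_on disc (inv_into disc h)"
    using g h by (auto simp: Diff_def)
  have him: "h ` disc \<subseteq> disc" using Diff_disc_mem[OF h] by blast
  have gim: "inv_into disc g ` disc \<subseteq> disc"
    using Bij_inv_into_mem[OF B(1)] by blast
  let ?k = "compose disc g h"
  have kB: "?k \<in> Bij disc" using B compose_Bij by blast
  have ks: "smooth_on disc ?k"
    by (rule smooth_on_cong[OF smooth_on_compose[OF sm him]]) (simp add: compose_def)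
  have "inv_into disc ?k x = inv_into disc h (inv_into disc g x)" if x: "x \<in> disc" for x
  proof (rule inv_into_f_eq)
    show "inj_on ?k disc" using kB by (simp add: Bij_def bij_betw_def)
    have gx: "inv_into disc g x \<in> disc" using Bij_inv_into_mem[OF B(1) x] .
    then show m: "inv_into disc h (inv_into disc g x) \<in> disc" by (rule Bij_inv_into_mem[OF B(2)])
    show "?k (inv_into disc h (inv_into disc g x)) = x"
      using m gx x B by (simp add: compose_def Bij_def bij_betw_def f_inv_into_f)
  qed
  then have "smooth_on disc (inv_into disc ?k)"
    using smooth_on_cong[OF smooth_on_compose[OF smi(2,1) gim]] by metis
  then have "?k \<in> Diff disc" using kB ks by (simp add: Diff_def)
  moreover have "pullback2 disc ?k omega p = omega p" if p: "p \<in> disc" for p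
  proof (intro ext)
    fix u v
    let ?D = "frechet_derivative h (at p within disc)"
    have kp: "h p \<in> disc" using him p by blast
    have D: "frechet_derivative ?k (at p within disc) w
        = frechet_derivative g (at (h p) within disc) (?D w)" for w
      by (rule disc_derivative_compose[OF sm him p]) (simp add: compose_def)
    have "pullback2 disc ?k omega p u v = pullback2 disc g omega (h p) (?D u) (?D v)"
      by (simp add: pullback2_def D omega_def)
    also have "\<dots> = omega (h p) (?D u) (?D v)" using sg[OF kp] by simp
    also have "\<dots> = pullback2 disc h omega p u v" by (simp add: pullback2_def)
    also have "\<dots> = omega p u v" using sh[OF p] by simp
    finally show "pullback2 disc ?k omega p u v = omega p u v" .
  qed
  ultimately have "?k \<in> carrier Symp" by (simp add: Symp_def)
  then show "g \<otimes>\<^bsub>BijGroup disc\<^esub> h \<in> carrier Symp"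
    using B by (simp add: BijGroup_def)
qed

lemma Symp_group: "group Symp"
  using subgroup.subgroup_is_group[OF Symp_subgroup group_BijGroup] by (simp add: Symp_def)

lemma Symp0_subgroup: "subgroup (carrier Symp0) Symp"
proof (rule group.subgroupI[OF Symp_group])
  have z: "(0, 0) \<in> disc" by (simp add: disc_def)
  show "carrier Symp0 \<subseteq> carrier Symp" by (auto simp: Symp0_def)
  have "\<one>\<^bsub>Symp\<^esub> \<in> carrier Symp" using Symp_group by (rule group.is_monoid[THEN monoid.one_closed])
  moreover have "\<one>\<^bsub>Symp\<^esub> (0, 0) = (0, 0)" using z by (simp add: Symp_def BijGroup_def)
  ultimately show "carrier Symp0 \<noteq> {}" by (auto simp: Symp0_def)
  have B: "g \<in> Bij disc" if "g \<in> carrier Symp" for g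
    using that by (simp add: Symp_def Diff_def)
  show "inv\<^bsub>Symp\<^esub> g \<in> carrier Symp0" if "g \<in> carrier Symp0" for g
  proof -
    have g: "g \<in> carrier Symp" "g (0, 0) = (0, 0)" using that by (auto simp: Symp0_def)
    have i: "inv\<^bsub>Symp\<^esub> g \<in> carrier Symp" using Symp_group g(1) by (rule group.inv_closed)
    have "inv\<^bsub>Symp\<^esub> g \<otimes>\<^bsub>Symp\<^esub> g = \<one>\<^bsub>Symp\<^esub>"
      using Symp_group g(1) by (rule group.l_inv)
    then have "compose disc (inv\<^bsub>Symp\<^esub> g) g = (\<lambda>x\<in>disc. x)"
      using B[OF g(1)] B[OF i] by (simp add: Symp_def BijGroup_def)
    then have "compose disc (inv\<^bsub>Symp\<^esub> g) g (0, 0) = (0, 0)" using z by simp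
    then show ?thesis using i g(2) z by (simp add: Symp0_def compose_def)
  qed
  show "g \<otimes>\<^bsub>Symp\<^esub> h \<in> carrier Symp0" if "g \<in> carrier Symp0" "h \<in> carrier Symp0" for g h
  proof -
    have g: "g \<in> carrier Symp" "g (0, 0) = (0, 0)" and h: "h \<in> carrier Symp" "h (0, 0) = (0, 0)"
      using that by (auto simp: Symp0_def)
    have "g \<otimes>\<^bsub>Symp\<^esub> h \<in> carrier Symp"
      by (rule monoid.m_closed[OF group.is_monoid[OF Symp_group] g(1) h(1)])
    moreover have "g \<otimes>\<^bsub>Symp\<^esub> h = compose disc g h"
      using B[OF g(1)] B[OF h(1)] by (simp add: Symp_def BijGroup_def)
    ultimately show ?thesis
      using g(2) h(2) z by (simp add: Symp0_def compose_def)
  qed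
qed

lemma Symp0_group: "group Symp0"
  using subgroup.subgroup_is_group[OF Symp0_subgroup Symp_group] by (simp add: Symp0_def)

lemma inclusion_hom: "id \<in> hom Symp0 Symp"
  using group.is_monoid[OF Symp_group] by (auto simp: hom_def Symp0_def monoid.m_closed)

lemma tau_cochain: "tau \<in> cochains1 Symp0"
  by (simp add: cochains1_def tau_def)

lemma ILM_cochain: "ILM_cocycle \<alpha> x0 \<in> cochains2 Symp"
  by (auto simp: cochains2_def ILM_cocycle_def)

end

theory Submission
  imports Defs
begin

text \<open>For a symplectomorphism \<open>g\<close> of the disc the form \<open>g\<^sup>*\<eta> - \<eta>\<close> is closed, because
  \<open>d (g\<^sup>*\<eta>) = g\<^sup>*\<omega> = \<omega> = d \<eta>\<close>; hence it has a potential \<open>F\<^sub>g\<close> on the disc, all the way up to the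
  boundary.  Line integrals are differences of values of the potential, and
  \<open>F\<^sub>g \<circ> h + F\<^sub>h\<close> is a potential for \<open>g h\<close>.  If \<open>h\<close> fixes the origin, then
  \<open>\<tau> (g h) - \<tau> h - \<tau> g = F\<^sub>g (h (1, 0)) - F\<^sub>g (1, 0)\<close>, which is the value of the cocycle.\<close>

section \<open>Derivatives along lines and the symmetry of second derivatives\<close>

text \<open>The chain rule with derivatives relative to sets on both sides: \<open>S\<close> may be
  a closed domain and \<open>T\<close> a closed interval, so boundary points and one-sided
  derivatives at the ends of \<open>T\<close> are covered.\<close>

lemma has_vector_derivative_line:
  assumes "(f has_derivative f') (at (q + t *\<^sub>R w) within S)"
    and "\<And>s. s \<in> T \<Longrightarrow> q + s *\<^sub>R w \<in> S"
  shows "((\<lambda>s. f (q + s *\<^sub>R w)) has_vector_derivative f' w) (at t within T)"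
proof -
  have "((\<lambda>s. q + s *\<^sub>R w) has_derivative (\<lambda>s. s *\<^sub>R w)) (at t within T)"
    by (auto intro!: derivative_eq_intros)
  moreover have "(f has_derivative f') (at (q + t *\<^sub>R w) within (\<lambda>s. q + s *\<^sub>R w) ` T)"
    by (rule has_derivative_subset[OF assms(1)]) (use assms(2) in auto)
  ultimately have "((\<lambda>s. f (q + s *\<^sub>R w)) has_derivative (\<lambda>s. f' (s *\<^sub>R w))) (at t within T)"
    using diff_chain_within[of "\<lambda>s. q + s *\<^sub>R w"] by (auto simp: o_def)
  then show ?thesis
    using linear_scale[OF has_derivative_linear[OF assms(1)]] by (simp add: has_vector_derivative_def)
qed

text \<open>Leibniz's rule differentiates
  \<open>f (x, y) - f (x, 0) = \<integral>\<^sub>0\<^sup>y \<partial>\<^sub>y f (x, s) ds\<close> with respect to \<open>x\<close>; the result is then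
  differentiated with respect to \<open>y\<close>.\<close>

lemma second_derivative_symmetric:
  fixes f :: "'a::euclidean_space \<Rightarrow> 'b::euclidean_space"
  assumes U: "open U" "p \<in> U" and f: "C_k_on 2 f U"
  shows "frechet_derivative (\<lambda>x. frechet_derivative f (at x) v) (at p) w
       = frechet_derivative (\<lambda>x. frechet_derivative f (at x) w) (at p) v"
proof -
  \<comment> \<open>\<open>D u\<close> is the derivative of \<open>f\<close> in direction
    \<open>u\<close>, and \<open>DD u u'\<close> that of \<open>D u\<close> in direction
    \<open>u'\<close>. The claim becomes \<open>DD v w p = DD w v p\<close>.\<close>
  define D where "D u x = frechet_derivative f (at x) u" for u x
  define DD where "DD u u' x = frechet_derivative (D u) (at x) u'" for u u' x
  have f2: "C_k_on (Suc (Suc 0)) f U" using f by (simp only: numeral_2_eq_2)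
  have Df: "(f has_derivative (\<lambda>u. D u x)) (at x)" if "x \<in> U" for x
    using C_k_on_SucD[OF f2 that] by (simp add: D_def)
  have C1: "C_k_on (Suc 0) (D u) U" for u
    using f2 unfolding D_def C_k_on.simps by blast
  have DDf: "(D u has_derivative (\<lambda>u'. DD u u' x)) (at x)" if "x \<in> U" for u x
    using C_k_on_SucD[OF C1 that] by (simp add: DD_def)
  have cD: "continuous_on U (D u)" for u
    using C_k_on_Suc_imp[OF C1] by simp
  have cDD: "continuous_on U (DD u u')" for u u'
    using C1[of u] unfolding DD_def by simp
  obtain e where e: "e > 0" "ball p e \<subseteq> U" using U openE by blast
  \<comment> \<open>The scale is chosen so that the parallelogram of all
    \<open>p + x *\<^sub>R v + y *\<^sub>R w\<close> with \<open>x\<close>, \<open>y\<close> in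
    \<open>{0..r}\<close> lies in the ball. The summand 1 keeps the denominator positive when both
    directions vanish.\<close>
  define r where "r = e / (norm v + norm w + 1)"
  have pos: "norm v + norm w + 1 > 0"
    by (metis add_nonneg_pos norm_ge_zero add_nonneg_nonneg zero_less_one)
  have r: "r > 0" using e pos by (simp add: r_def)
  have inU: "p + x *\<^sub>R v + y *\<^sub>R w \<in> U" if "x \<in> {0..r}" "y \<in> {0..r}" for x y
  proof -
    have "norm (x *\<^sub>R v + y *\<^sub>R w) \<le> x * norm v + y * norm w"
      using norm_triangle_ineq[of "x *\<^sub>R v" "y *\<^sub>R w"] that by simp
    also have "\<dots> \<le> r * norm v + r * norm w"
      using that by (intro add_mono mult_right_mono) auto
    also have "\<dots> < r * (norm v + norm w + 1)"
      using r by (simp add: algebra_simps)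
    also have "\<dots> = e" using pos by (simp add: r_def)
    finally have "dist (p + (x *\<^sub>R v + y *\<^sub>R w)) p < e"
      by (simp add: dist_norm)
    then show ?thesis
      using e(2) by (auto simp: add.assoc dist_commute)
  qed
  have inU': "p + y *\<^sub>R w + x *\<^sub>R v \<in> U" if "x \<in> {0..r}" "y \<in> {0..r}" for x y
    using inU[OF that] by (simp add: algebra_simps)
  have dy: "((\<lambda>y. g (p + x *\<^sub>R v + y *\<^sub>R w)) has_vector_derivative g' (p + x *\<^sub>R v + y *\<^sub>R w) w) (at y within {0..r})"
    if "\<And>z. z \<in> U \<Longrightarrow> (g has_derivative g' z) (at z)" "x \<in> {0..r}" "y \<in> {0..r}"
    for g :: "'a \<Rightarrow> 'b" and g' x y
    by (rule has_vector_derivative_line[where S = UNIV]) (use that inU in auto)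
  have dx: "((\<lambda>x. g (p + x *\<^sub>R v + y *\<^sub>R w)) has_vector_derivative g' (p + x *\<^sub>R v + y *\<^sub>R w) v) (at x within {0..r})"
    if "\<And>z. z \<in> U \<Longrightarrow> (g has_derivative g' z) (at z)" "x \<in> {0..r}" "y \<in> {0..r}"
    for g :: "'a \<Rightarrow> 'b" and g' x y
  proof -
    have "((\<lambda>x. g (p + y *\<^sub>R w + x *\<^sub>R v)) has_vector_derivative g' (p + y *\<^sub>R w + x *\<^sub>R v) v) (at x within {0..r})"
      by (rule has_vector_derivative_line[where S = UNIV]) (use that inU' in auto)
    then show ?thesis by (simp add: algebra_simps)
  qed
  have cy: "continuous_on {0..r} (\<lambda>y. g (p + x *\<^sub>R v + y *\<^sub>R w))"
    if "continuous_on U g" "x \<in> {0..r}" for g :: "'a \<Rightarrow> 'b" and x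
    by (rule continuous_on_compose2[OF that(1)]) (use inU that in \<open>auto intro!: continuous_intros\<close>)
  have z: "0 \<in> {0..r}" using r by simp
  have nontriv: "at 0 within {0..r} \<noteq> bot"
    using r by (simp add: trivial_limit_within islimpt_Icc)
  have D_diff: "D v (p + y *\<^sub>R w) - D v p = integral {0..y} (\<lambda>s. DD w v (p + s *\<^sub>R w))"
    if y: "y \<in> {0..r}" for y
  proof -
    have ftc: "f (p + x *\<^sub>R v + y *\<^sub>R w) - f (p + x *\<^sub>R v) = integral {0..y} (\<lambda>s. D w (p + x *\<^sub>R v + s *\<^sub>R w))"
      if x: "x \<in> {0..r}" for x
    proof -
      have "((\<lambda>s. D w (p + x *\<^sub>R v + s *\<^sub>R w)) has_integral
          f (p + x *\<^sub>R v + y *\<^sub>R w) - f (p + x *\<^sub>R v + 0 *\<^sub>R w)) {0..y}"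
        by (rule fundamental_theorem_of_calculus)
           (use y in \<open>auto intro!: has_vector_derivative_within_subset[OF dy[OF Df x]]\<close>)
      then show ?thesis by (simp add: integral_unique)
    qed
    \<comment> \<open>Differentiation under the integral sign rests on the joint continuity of the
      integrand's derivative, which is where the continuity of the second derivatives of
      \<open>f\<close> enters.\<close>
    have "((\<lambda>x. integral {0..y} (\<lambda>s. D w (p + x *\<^sub>R v + s *\<^sub>R w))) has_vector_derivative
        integral {0..y} (\<lambda>s. DD w v (p + 0 *\<^sub>R v + s *\<^sub>R w))) (at 0 within {0..r})"
      unfolding cbox_interval[symmetric]
    proof (rule leibniz_rule_vector_derivative)
      show "((\<lambda>x. D w (p + x *\<^sub>R v + t *\<^sub>R w)) has_vector_derivative DD w v (p + x *\<^sub>R v + t *\<^sub>R w))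
          (at x within cbox 0 r)" if "x \<in> cbox 0 r" "t \<in> cbox 0 y" for x t
        using dx[OF DDf, of x t w] that y by simp
      show "(\<lambda>s. D w (p + x *\<^sub>R v + s *\<^sub>R w)) integrable_on cbox 0 y" if "x \<in> cbox 0 r" for x
        by (rule integrable_continuous) (use y that continuous_on_subset[OF cy[OF cD]] in auto)
      show "continuous_on (cbox 0 r \<times> cbox 0 y) (\<lambda>(x, t). DD w v (p + x *\<^sub>R v + t *\<^sub>R w))"
        unfolding split_beta
        by (rule continuous_on_compose2[OF cDD]) (use inU y in \<open>auto intro!: continuous_intros\<close>)
    qed (use r in auto)
    then have "((\<lambda>x. integral {0..y} (\<lambda>s. D w (p + x *\<^sub>R v + s *\<^sub>R w))) has_vector_derivative
        integral {0..y} (\<lambda>s. DD w v (p + s *\<^sub>R w))) (at 0 within {0..r})"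
      by (simp only: scaleR_zero_left add_0_right)
    then have "((\<lambda>x. f (p + x *\<^sub>R v + y *\<^sub>R w) - f (p + x *\<^sub>R v)) has_vector_derivative
        integral {0..y} (\<lambda>s. DD w v (p + s *\<^sub>R w))) (at 0 within {0..r})"
      by (rule has_vector_derivative_transform[OF z, rotated]) (simp add: ftc)
    \<comment> \<open>The same difference, now differentiated without the integral; uniqueness of
      the one-sided derivative at 0 equates the two results.\<close>
    moreover have "((\<lambda>x. f (p + x *\<^sub>R v + y *\<^sub>R w) - f (p + x *\<^sub>R v)) has_vector_derivative
        D v (p + y *\<^sub>R w) - D v p) (at 0 within {0..r})"
      using has_vector_derivative_diff[OF dx[OF Df z y] dx[OF Df z z]] by simp
    ultimately show ?thesis
      by (rule vector_derivative_unique_within[OF nontriv, symmetric])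
  qed
  \<comment> \<open>Both sides of \<open>D_diff\<close> are differentiated in \<open>y\<close> at 0:
    the integral yields \<open>DD w v p\<close>, the difference yields
    \<open>DD v w p\<close>.\<close>
  have "((\<lambda>y. integral {0..y} (\<lambda>s. DD w v (p + s *\<^sub>R w))) has_vector_derivative DD w v (p + 0 *\<^sub>R w)) (at 0 within {0..r})"
    by (rule integral_has_vector_derivative) (use cy[OF cDD z] z in auto)
  then have "((\<lambda>y. D v (p + y *\<^sub>R w) - D v p) has_vector_derivative DD w v p) (at 0 within {0..r})"
    by (auto intro: has_vector_derivative_transform[OF z] simp: D_diff)
  moreover have "((\<lambda>y. D v (p + y *\<^sub>R w) - D v p) has_vector_derivative DD v w p) (at 0 within {0..r})"
    using has_vector_derivative_diff[OF dy[OF DDf z z] has_vector_derivative_const] by simp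
  ultimately have "DD w v p = DD v w p"
    by (rule vector_derivative_unique_within[OF nontriv])
  then show ?thesis by (simp add: DD_def D_def[abs_def])
qed

section \<open>The Poincare lemma on convex sets and line integrals of exact forms\<close>

text \<open>The potential is \<open>F x = \<integral>\<^sub>0\<^sup>1 \<beta> (t x) x dt\<close>.  Closedness turns its derivative in direction \<open>w\<close>
  into the integral of \<open>d/dt (t \<beta> (t x) w)\<close>.\<close>

lemma poincare_convex:
  fixes \<beta> :: "'a::euclidean_space \<Rightarrow> 'a \<Rightarrow> real"
  assumes S: "convex S" "0 \<in> S"
    and lin: "\<And>p. p \<in> S \<Longrightarrow> linear (\<beta> p)"
    and D: "\<And>p v. p \<in> S \<Longrightarrow> ((\<lambda>p. \<beta> p v) has_derivative (\<lambda>w. D p w v)) (at p within S)"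
    and cont: "\<And>v w. continuous_on S (\<lambda>p. D p w v)"
    and closed: "\<And>p v w. p \<in> S \<Longrightarrow> D p w v = D p v w"
  obtains F where "\<And>p. p \<in> S \<Longrightarrow> (F has_derivative \<beta> p) (at p within S)"
proof
  have tS: "t *\<^sub>R x \<in> S" if "x \<in> S" "t \<in> {0..1}" for x t
    using convexD[OF S(1) S(2) that(1), of "1 - t" t] that by simp
  have linD: "linear (\<lambda>w. D p w v)" "linear (D p v)" if "p \<in> S" for p v
  proof -
    show 1: "linear (\<lambda>w. D p w v)" using has_derivative_linear[OF D[OF that]] .
    \<comment> \<open>Linearity is known only in the direction of differentiation; closedness
      exchanges the two arguments and so carries it over to the other one.\<close>
    have "D p v = (\<lambda>w. D p w v)" using closed[OF that] by (intro ext) metis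
    with 1 show "linear (D p v)" by metis
  qed
  have cont\<beta>: "continuous_on S (\<lambda>p. \<beta> p v)" for v
    by (rule has_derivative_continuous_on[OF D])
  \<comment> \<open>The hypotheses on \<beta> and \<open>D\<close> are about fixed vectors, whereas
    the integrand of the potential has the moving point \<open>x\<close> in the vector slot.
    Expansion in the basis reduces to fixed vectors with coefficients
    \<open>x \<bullet> b\<close>.\<close>
  have expand: "f x = (\<Sum>b\<in>Basis. (x \<bullet> b) * f b)" if "linear f" for f :: "'a \<Rightarrow> real" and x
  proof -
    have "f x = f (\<Sum>b\<in>Basis. (x \<bullet> b) *\<^sub>R b)" by (simp add: euclidean_representation)
    also have "\<dots> = (\<Sum>b\<in>Basis. (x \<bullet> b) * f b)"
      by (simp only: linear_sum[OF that] linear_scale[OF that] real_scaleR_def)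
    finally show ?thesis .
  qed
  have \<beta>_sum: "\<beta> p x = (\<Sum>b\<in>Basis. (x \<bullet> b) * \<beta> p b)" if "p \<in> S" for p x
    by (rule expand[OF lin[OF that]])
  have D_sum: "D p w x = (\<Sum>b\<in>Basis. (x \<bullet> b) * D p w b)" if "p \<in> S" for p w x
    by (rule expand[OF linD(2)[OF that]])
  define F where "F x = integral (cbox 0 1) (\<lambda>t. \<beta> (t *\<^sub>R x) x)" for x
  \<comment> \<open>The derivative of the integrand with respect to \<open>x\<close>, by the product
    and chain rules: the vector slot contributes the first term, the base point
    \<open>t *\<^sub>R x\<close> the second. It is packed as a bounded linear map because Leibniz's
    rule asks for a continuous family of such maps.\<close>
  define L where "L x t = Blinfun (\<lambda>w. \<beta> (t *\<^sub>R x) w + t * D (t *\<^sub>R x) w x)" for x t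
  have L: "blinfun_apply (L x t) w = \<beta> (t *\<^sub>R x) w + t * D (t *\<^sub>R x) w x"
    if "x \<in> S" "t \<in> {0..1}" for x t w
  proof -
    have "linear (\<lambda>w. \<beta> (t *\<^sub>R x) w + t * D (t *\<^sub>R x) w x)"
      using lin[OF tS[OF that]] linD(1)[OF tS[OF that]]
      by (auto simp: linear_iff algebra_simps)
    then show ?thesis
      unfolding L_def by (subst bounded_linear_Blinfun_apply) (simp_all add: linear_conv_bounded_linear)
  qed
  have Lcont: "continuous_on (S \<times> cbox 0 1) (\<lambda>(x, t). L x t)"
  \<comment> \<open>In finite dimension it suffices to test continuity on each fixed vector
    \<open>w\<close>.\<close>
  proof (rule continuous_on_blinfun_componentwise)
    fix w :: 'a
    have c: "continuous_on (S \<times> cbox 0 1) (\<lambda>z. g (snd z *\<^sub>R fst z))"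
      if "continuous_on S g" for g :: "'a \<Rightarrow> real"
      by (rule continuous_on_compose2[OF that]) (auto intro!: continuous_intros tS)
    have "continuous_on (S \<times> cbox 0 1) (\<lambda>z. \<beta> (snd z *\<^sub>R fst z) w
        + snd z * (\<Sum>b\<in>Basis. (fst z \<bullet> b) * D (snd z *\<^sub>R fst z) w b))"
      by (intro continuous_intros c[OF cont\<beta>] c[OF cont])
    then show "continuous_on (S \<times> cbox 0 1) (\<lambda>z. blinfun_apply (case z of (x, t) \<Rightarrow> L x t) w)"
    proof (rule continuous_on_eq)
      fix z assume "z \<in> S \<times> cbox (0::real) 1"
      then obtain x t where z: "z = (x, t)" "x \<in> S" "t \<in> {0..1}" by auto
      show "\<beta> (snd z *\<^sub>R fst z) w + snd z * (\<Sum>b\<in>Basis. (fst z \<bullet> b) * D (snd z *\<^sub>R fst z) w b)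
          = blinfun_apply (case z of (x, t) \<Rightarrow> L x t) w"
        unfolding z(1) prod.case fst_conv snd_conv L[OF z(2,3)] D_sum[OF tS[OF z(2,3)], of w x] ..
    qed
  qed
  show "(F has_derivative \<beta> x) (at x within S)" if x: "x \<in> S" for x
  proof -
    have "(F has_derivative blinfun_apply (integral (cbox 0 1) (L x))) (at x within S)"
      unfolding F_def[abs_def]
    proof (rule leibniz_rule[OF _ _ Lcont x S(1)])
      fix y and t :: real assume y: "y \<in> S" and t: "t \<in> cbox 0 1"
      have ty: "t *\<^sub>R y \<in> S" using tS y t by auto
      have D': "((\<lambda>x. \<beta> (t *\<^sub>R x) b) has_derivative (\<lambda>w. D (t *\<^sub>R y) (t *\<^sub>R w) b)) (at y within S)" for b
      proof -
        have "((\<lambda>p. \<beta> p b) has_derivative (\<lambda>w. D (t *\<^sub>R y) w b)) (at (t *\<^sub>R y) within (\<lambda>x. t *\<^sub>R x) ` S)"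
          by (rule has_derivative_subset[OF D[OF ty]]) (use tS t in auto)
        moreover have "((\<lambda>x. t *\<^sub>R x) has_derivative (\<lambda>w. t *\<^sub>R w)) (at y within S)"
          by (auto intro!: derivative_eq_intros)
        ultimately show ?thesis
          using diff_chain_within[of "\<lambda>x. t *\<^sub>R x"] by (auto simp: o_def)
      qed
      have "((\<lambda>x. \<Sum>b\<in>Basis. (x \<bullet> b) * \<beta> (t *\<^sub>R x) b) has_derivative
          (\<lambda>w. \<Sum>b\<in>Basis. (y \<bullet> b) * D (t *\<^sub>R y) (t *\<^sub>R w) b + (w \<bullet> b) * \<beta> (t *\<^sub>R y) b)) (at y within S)"
        by (intro has_derivative_sum has_derivative_mult D' has_derivative_inner_left has_derivative_ident)
      moreover have "(\<lambda>w. \<Sum>b\<in>Basis. (y \<bullet> b) * D (t *\<^sub>R y) (t *\<^sub>R w) b + (w \<bullet> b) * \<beta> (t *\<^sub>R y) b)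
          = blinfun_apply (L y t)"
      proof
        fix w
        have "(\<Sum>b\<in>Basis. (y \<bullet> b) * D (t *\<^sub>R y) (t *\<^sub>R w) b + (w \<bullet> b) * \<beta> (t *\<^sub>R y) b)
            = D (t *\<^sub>R y) (t *\<^sub>R w) y + \<beta> (t *\<^sub>R y) w"
          unfolding sum.distrib D_sum[OF ty, of _ y] \<beta>_sum[OF ty, of w] ..
        also have "\<dots> = blinfun_apply (L y t) w"
          using L[OF y, of t w] t linear_scale[OF linD(1)[OF ty]] by simp
        finally show "(\<Sum>b\<in>Basis. (y \<bullet> b) * D (t *\<^sub>R y) (t *\<^sub>R w) b + (w \<bullet> b) * \<beta> (t *\<^sub>R y) b)
            = blinfun_apply (L y t) w" .
      qed
      ultimately have "((\<lambda>x. \<Sum>b\<in>Basis. (x \<bullet> b) * \<beta> (t *\<^sub>R x) b) has_derivative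
          blinfun_apply (L y t)) (at y within S)" by simp
      then show "((\<lambda>x. \<beta> (t *\<^sub>R x) x) has_derivative blinfun_apply (L y t)) (at y within S)"
        by (rule has_derivative_transform[OF y, rotated], intro \<beta>_sum tS) (use t in auto)
    next
      fix y assume y: "y \<in> S"
      have "continuous_on (cbox 0 1) (\<lambda>t. \<Sum>b\<in>Basis. (y \<bullet> b) * \<beta> (t *\<^sub>R y) b)"
        by (intro continuous_intros continuous_on_compose2[OF cont\<beta>])
           (use tS y in \<open>auto intro!: continuous_intros\<close>)
      then have "continuous_on (cbox 0 1) (\<lambda>t. \<beta> (t *\<^sub>R y) y)"
        by (rule continuous_on_eq, intro \<beta>_sum[symmetric] tS) (use y in auto)
      then show "(\<lambda>t. \<beta> (t *\<^sub>R y) y) integrable_on cbox 0 1"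
        by (rule integrable_continuous)
    qed
    moreover have "blinfun_apply (integral (cbox 0 1) (L x)) = \<beta> x"
    proof
      fix w
      have "continuous_on (cbox 0 1) (\<lambda>t. case (x, t) of (x, t) \<Rightarrow> L x t)"
        by (rule continuous_on_compose2[OF Lcont]) (use x in \<open>auto intro!: continuous_intros\<close>)
      then have "blinfun_apply (integral (cbox 0 1) (L x)) w = integral {0..1} (\<lambda>t. blinfun_apply (L x t) w)"
        by (subst blinfun_apply_integral) (auto intro: integrable_continuous_real)
      also have "\<dots> = integral {0..1} (\<lambda>t. \<beta> (t *\<^sub>R x) w + t * D (t *\<^sub>R x) x w)"
        by (rule integral_cong) (use L[OF x] closed tS[OF x] in auto)
      \<comment> \<open>The primitive is \<open>t * \<beta> (t *\<^sub>R x) w\<close>: the factor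
        \<open>t\<close> removes the contribution at 0, and the end point 1 leaves
        \<open>\<beta> x w\<close>.\<close>
      also have "\<dots> = 1 * \<beta> (1 *\<^sub>R x) w - 0 * \<beta> (0 *\<^sub>R x) w"
      proof (rule integral_unique, rule fundamental_theorem_of_calculus)
        fix t :: real assume t: "t \<in> {0..1}"
        have "((\<lambda>t. \<beta> (0 + t *\<^sub>R x) w) has_vector_derivative D (t *\<^sub>R x) x w) (at t within {0..1})"
          by (rule has_vector_derivative_line[where S = S]) (use D tS x t in auto)
        then have "((\<lambda>t. \<beta> (t *\<^sub>R x) w) has_real_derivative D (t *\<^sub>R x) x w) (at t within {0..1})"
          by (simp add: has_real_derivative_iff_has_vector_derivative)
        then have "((\<lambda>t. t * \<beta> (t *\<^sub>R x) w) has_real_derivative \<beta> (t *\<^sub>R x) w + t * D (t *\<^sub>R x) x w) (at t within {0..1})"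
          by (auto intro!: derivative_eq_intros)
        then show "((\<lambda>t. t * \<beta> (t *\<^sub>R x) w) has_vector_derivative \<beta> (t *\<^sub>R x) w + t * D (t *\<^sub>R x) x w) (at t within {0..1})"
          by (simp add: has_real_derivative_iff_has_vector_derivative)
      qed simp
      finally show "blinfun_apply (integral (cbox 0 1) (L x)) w = \<beta> x w" by simp
    qed
    ultimately show ?thesis by simp
  qed
qed

text \<open>The fundamental theorem of calculus for \<open>F\<close> composed with \<open>p\<close>.
  Since \<open>F\<close> is differentiated only within \<open>S\<close>, the path may run along the
  boundary of \<open>S\<close>.\<close>

lemma has_line_integral_potential:
  assumes F: "\<And>x. x \<in> S \<Longrightarrow> (F has_derivative \<beta> x) (at x within S)"
    and p: "valid_path p" "path_image p \<subseteq> S"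
  shows "has_line_integral \<beta> (F (pathfinish p) - F (pathstart p)) p"
proof -
  obtain T where cont: "continuous_on {0..1} p" and T: "finite T" "p C1_differentiable_on ({0..1} - T)"
    using p(1) by (auto simp: valid_path_def piecewise_C1_differentiable_on_def)
  have pS: "p t \<in> S" if "t \<in> {0..1}" for t using that p(2) by (auto simp: path_image_def)
  have "((\<lambda>t. \<beta> (p t) (vector_derivative p (at t within {0..1}))) has_integral F (p 1) - F (p 0)) {0..1}"
  \<comment> \<open>This form of the theorem asks for continuity on the closed interval and for
    derivatives only at interior points off the finite set \<open>T\<close> of break points. At
    interior points the derivative within \<open>{0..1}\<close> is the ordinary one.\<close>
  proof (rule fundamental_theorem_of_calculus_interior_strong[OF T(1)])
    have "continuous_on S F" by (rule has_derivative_continuous_on[OF F])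
    then show "continuous_on {0..1} (\<lambda>t. F (p t))"
      by (rule continuous_on_compose2[OF _ cont]) (use pS in auto)
  next
    fix t assume t: "t \<in> {0<..<1} - T"
    then have "p differentiable at t" using T(2) by (auto simp: C1_differentiable_on_eq)
    then have "(p has_vector_derivative vector_derivative p (at t)) (at t)"
      by (simp add: vector_derivative_works)
    moreover have int: "at t within {0..1} = at t"
      using t by (intro at_within_interior) auto
    ultimately have "(p has_derivative (\<lambda>s. s *\<^sub>R vector_derivative p (at t))) (at t within {0..1})"
      by (simp add: has_vector_derivative_def)
    moreover have "(F has_derivative \<beta> (p t)) (at (p t) within p ` {0..1})"
      by (rule has_derivative_subset[OF F]) (use pS t in auto)
    ultimately have "((\<lambda>t. F (p t)) has_derivative (\<lambda>s. \<beta> (p t) (s *\<^sub>R vector_derivative p (at t)))) (at t within {0..1})"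
      using diff_chain_within[of p] by (auto simp: o_def)
    moreover have "linear (\<beta> (p t))" using F pS t by (intro has_derivative_linear[OF F]) auto
    ultimately show "((\<lambda>t. F (p t)) has_vector_derivative \<beta> (p t) (vector_derivative p (at t within {0..1}))) (at t)"
      by (simp add: has_vector_derivative_def int linear_scale)
  qed simp
  then show ?thesis by (simp add: has_line_integral_def pathfinish_def pathstart_def)
qed

section \<open>Derivatives on the closed disc through local smooth extensions\<close>

text \<open>Derivatives within the disc are unique even at boundary points, so every local extension
  computes them. This carries results from open sets over to the closed disc.\<close>

lemma disc_derivative_extension:
  fixes f F :: "real \<times> real \<Rightarrow> 'b::euclidean_space"
  assumes U: "open U" "p \<in> disc \<inter> U"
    and F: "(F has_derivative F') (at p)" "\<And>y. y \<in> disc \<inter> U \<Longrightarrow> F y = f y"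
  shows "frechet_derivative f (at p within disc) = F'"
proof -
  have "\<forall>\<^sub>F y in at p within disc. F y = f y"
    unfolding eventually_at_topological using U F(2) by (intro exI[of _ U]) auto
  then have f: "(f has_derivative F') (at p within disc)"
    by (rule has_derivative_transform_eventually[OF has_derivative_at_withinI[OF F(1)]])
       (use U F(2) in auto)
  then show ?thesis
    using disc_derivative_unique[OF _ f] U
      frechet_derivative_works[THEN iffD1, OF differentiableI[OF f]] by auto
qed

text \<open>Differentiating a local smooth extension of \<open>f\<close> gives a local smooth
  extension of the derivative, because the two derivatives agree throughout the part of the disc in
  \<open>U\<close>.\<close>

lemma smooth_on_disc_derivative:
  fixes f :: "real \<times> real \<Rightarrow> 'b::euclidean_space"
  assumes f: "smooth_on disc f"
  shows "smooth_on disc (\<lambda>p. frechet_derivative f (at p within disc) v)"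
  unfolding smooth_on_def
proof
  fix x assume "x \<in> disc"
  then obtain U F where U: "open U" "x \<in> U" and F: "\<And>n. C_k_on n F U" "\<And>y. y \<in> disc \<inter> U \<Longrightarrow> F y = f y"
    using f unfolding smooth_on_def by metis
  have "C_k_on n (\<lambda>p. frechet_derivative F (at p) v) U" for n
    using F(1)[of "Suc n"] unfolding C_k_on.simps by blast
  moreover have "frechet_derivative F (at y) v = frechet_derivative f (at y within disc) v"
    if "y \<in> disc \<inter> U" for y
    using disc_derivative_extension[OF U(1) that C_k_on_SucD[OF F(1)] F(2)] that by simp
  ultimately show "\<exists>U F. open U \<and> x \<in> U \<and> (\<forall>n. C_k_on n F U)
      \<and> (\<forall>y\<in>disc \<inter> U. F y = frechet_derivative f (at y within disc) v)"
    using U by blast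
qed

text \<open>Both second derivatives equal those of a local smooth extension: the extension lemma
  applies once to \<open>f\<close> and once to its first derivative. On the open set the symmetry is
  already known.\<close>

lemma disc_second_derivative_symmetric:
  fixes f :: "real \<times> real \<Rightarrow> 'b::euclidean_space"
  assumes f: "smooth_on disc f" and p: "p \<in> disc"
  shows "frechet_derivative (\<lambda>p. frechet_derivative f (at p within disc) v) (at p within disc) w
       = frechet_derivative (\<lambda>p. frechet_derivative f (at p within disc) w) (at p within disc) v"
proof -
  obtain U F where U: "open U" "p \<in> U" and F: "\<And>n. C_k_on n F U" "\<And>y. y \<in> disc \<inter> U \<Longrightarrow> F y = f y"
    using f p unfolding smooth_on_def by metis
  have pU: "p \<in> disc \<inter> U" using p U by simp
  have F1: "C_k_on (Suc 0) (\<lambda>p. frechet_derivative F (at p) u) U" for u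
    using F(1)[of "Suc (Suc 0)"] unfolding C_k_on.simps by blast
  have "frechet_derivative F (at y) u = frechet_derivative f (at y within disc) u"
    if "y \<in> disc \<inter> U" for y u
    using disc_derivative_extension[OF U(1) that C_k_on_SucD[OF F(1)] F(2)] that by simp
  then have "frechet_derivative (\<lambda>p. frechet_derivative f (at p within disc) u) (at p within disc)
      = frechet_derivative (\<lambda>p. frechet_derivative F (at p) u) (at p)" for u
    by (rule disc_derivative_extension[OF U(1) pU C_k_on_SucD[OF F1 U(2)]])
  then show ?thesis
    using second_derivative_symmetric[OF U F(1)] by metis
qed

lemma smooth_on_continuous:
  assumes "smooth_on S f"
  shows "continuous_on S f"
  using has_derivative_continuous_on[OF smooth_on_has_derivative[OF assms]] .

section \<open>Potentials attached to symplectomorphisms\<close>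

text \<open>The Poincare lemma applies up to the boundary, since the disc is convex and
  \<open>g\<close> has continuous second derivatives there; closedness comes from the invariance of
  \<open>omega\<close>.\<close>

lemma Symp_potential:
  assumes "g \<in> carrier Symp"
  obtains F where "\<And>p. p \<in> disc \<Longrightarrow> (F has_derivative (pullback1 disc g eta - eta) p) (at p within disc)"
proof -
  have sm: "smooth_on disc g" and symp: "\<And>p. p \<in> disc \<Longrightarrow> pullback2 disc g omega p = omega p"
    using assms by (auto simp: Symp_def Diff_def)
  define A where "A v p = frechet_derivative g (at p within disc) v" for v p
  define H where "H v w p = frechet_derivative (A v) (at p within disc) w" for v w p
  have smA: "smooth_on disc (A v)" for v
    unfolding A_def[abs_def] by (rule smooth_on_disc_derivative[OF sm])
  have smH: "smooth_on disc (H v w)" for v w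
    unfolding H_def[abs_def] by (rule smooth_on_disc_derivative[OF smA])
  have dg: "(g has_derivative (\<lambda>v. A v p)) (at p within disc)" if "p \<in> disc" for p
    using smooth_on_has_derivative[OF sm that] by (simp add: A_def)
  have dA: "(A v has_derivative (\<lambda>w. H v w p)) (at p within disc)" if "p \<in> disc" for v p
    using smooth_on_has_derivative[OF smA that] by (simp add: H_def)
  have sym: "H v w p = H w v p" if "p \<in> disc" for v w p
    using disc_second_derivative_symmetric[OF sm that, of v w] by (simp add: H_def A_def[abs_def])
  have om: "fst (A v p) * snd (A w p) - snd (A v p) * fst (A w p) = fst v * snd w - snd v * fst w"
    if "p \<in> disc" for v w p
    using fun_cong[OF fun_cong[OF symp[OF that]], of v w] by (simp add: pullback2_def omega_def A_def)
  define \<beta> where "\<beta> = pullback1 disc g eta - eta"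
  have \<beta>: "\<beta> p v = (fst (g p) * snd (A v p) - snd (g p) * fst (A v p)) / 2 - (fst p * snd v - snd p * fst v) / 2"
    for p v by (simp add: \<beta>_def pullback1_def eta_def A_def)
  \<comment> \<open>The derivative at \<open>p\<close> in direction \<open>w\<close> of
    \<open>\<beta>\<close> evaluated on the fixed vector \<open>v\<close>, by the product
    rule.\<close>
  define D where "D p w v =
      (fst (A w p) * snd (A v p) + fst (g p) * snd (H v w p)
        - (snd (A w p) * fst (A v p) + snd (g p) * fst (H v w p))) / 2
      - (fst w * snd v - snd w * fst v) / 2" for p w v
  have "\<exists>F. \<forall>p\<in>disc. (F has_derivative \<beta> p) (at p within disc)"
  proof (rule poincare_convex)
    show "convex disc" "0 \<in> disc" by (simp_all add: disc_cball)
    show "linear (\<beta> p)" if "p \<in> disc" for p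
    proof -
      have "linear (\<lambda>v. A v p)" using has_derivative_linear[OF dg[OF that]] .
      then have "A (v + w) p = A v p + A w p" "A (c *\<^sub>R v) p = c *\<^sub>R A v p" for v w c
        using linear_add linear_scale by blast+
      then show ?thesis by (auto simp: linear_iff \<beta> algebra_simps add_divide_distrib diff_divide_distrib)
    qed
    show "((\<lambda>p. \<beta> p v) has_derivative (\<lambda>w. D p w v)) (at p within disc)" if "p \<in> disc" for p v
    proof -
      have "((\<lambda>p. fst (g p) * snd (A v p) - snd (g p) * fst (A v p)) has_derivative
          (\<lambda>w. (fst (g p) * snd (H v w p) + fst (A w p) * snd (A v p))
            - (snd (g p) * fst (H v w p) + snd (A w p) * fst (A v p)))) (at p within disc)"
        by (intro has_derivative_diff has_derivative_mult has_derivative_fst has_derivative_snd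
            dg[OF that] dA[OF that])
      moreover have "((\<lambda>p. fst p * snd v - snd p * fst v) has_derivative
          (\<lambda>w. fst w * snd v - snd w * fst v)) (at p within disc)"
        by (intro has_derivative_diff has_derivative_mult_left has_derivative_fst has_derivative_snd
            has_derivative_ident)
      ultimately have "((\<lambda>p. \<beta> p v) has_derivative
          (\<lambda>w. ((fst (g p) * snd (H v w p) + fst (A w p) * snd (A v p))
            - (snd (g p) * fst (H v w p) + snd (A w p) * fst (A v p))) / 2
            - (fst w * snd v - snd w * fst v) / 2)) (at p within disc)"
        unfolding \<beta>
        by (intro has_derivative_diff[OF bounded_linear.has_derivative[OF bounded_linear_divide]
              bounded_linear.has_derivative[OF bounded_linear_divide]])
      then show ?thesis
        by (rule has_derivative_eq_rhs) (simp add: D_def fun_eq_iff)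
    qed
    show "continuous_on disc (\<lambda>p. D p w v)" for v w
      unfolding D_def
      by (intro continuous_intros smooth_on_continuous[OF sm] smooth_on_continuous[OF smA]
          smooth_on_continuous[OF smH]) simp_all
    \<comment> \<open>Exchanging \<open>v\<close> and \<open>w\<close> cancels the terms in
      \<open>H\<close> by symmetry; what remains of the difference is \<open>omega\<close> on
      \<open>A w p\<close>, \<open>A v p\<close> minus \<open>omega\<close> on \<open>w\<close>,
      \<open>v\<close>, which is zero by \<open>om\<close>.\<close>
    show "D p w v = D p v w" if "p \<in> disc" for p v w
      using om[OF that, of v w] sym[OF that, of v w] unfolding D_def by (simp add: field_simps)
  qed blast
  then show ?thesis using that unfolding \<beta>_def by blast
qed

section \<open>The cocycle and the cochain as differences of potentials\<close>

text \<open>The potential supplies one value valid for all admissible paths. Uniqueness in the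
  definite description needs an admissible path to exist: the segment from \<open>x0\<close> to
  \<open>h x0\<close>, which stays in the disc by convexity.\<close>

lemma ILM_cocycle_potential:
  assumes g: "g \<in> carrier Symp" and h: "h \<in> carrier Symp" and x0: "x0 \<in> disc"
    and F: "\<And>p. p \<in> disc \<Longrightarrow> (F has_derivative (pullback1 disc g \<alpha> - \<alpha>) p) (at p within disc)"
  shows "ILM_cocycle \<alpha> x0 g h = F (h x0) - F x0"
proof -
  let ?ok = "\<lambda>p. valid_path p \<and> path_image p \<subseteq> disc \<and> pathstart p = x0 \<and> pathfinish p = h x0"
  have *: "has_line_integral (pullback1 disc g \<alpha> - \<alpha>) (F (h x0) - F x0) p" if "?ok p" for p
    using has_line_integral_potential[of disc F "pullback1 disc g \<alpha> - \<alpha>" p] F that by auto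
  have "h x0 \<in> disc" using Diff_disc_mem h x0 by (auto simp: Symp_def)
  then have ok: "?ok (linepath x0 (h x0))"
    using x0 by (simp add: disc_cball closed_segment_subset)
  have "(THE c. \<forall>p. ?ok p \<longrightarrow> has_line_integral (pullback1 disc g \<alpha> - \<alpha>) c p) = F (h x0) - F x0"
  proof (rule the_equality)
    fix c assume "\<forall>p. ?ok p \<longrightarrow> has_line_integral (pullback1 disc g \<alpha> - \<alpha>) c p"
    then have "has_line_integral (pullback1 disc g \<alpha> - \<alpha>) c (linepath x0 (h x0))"
      using ok by blast
    from has_integral_unique[OF this[unfolded has_line_integral_def] *[OF ok, unfolded has_line_integral_def]]
    show "c = F (h x0) - F x0" .
  qed (use * in blast)
  then show ?thesis using g h by (simp add: ILM_cocycle_def)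
qed

lemma tau_potential:
  assumes g: "g \<in> carrier Symp0"
    and F: "\<And>p. p \<in> disc \<Longrightarrow> (F has_derivative (pullback1 disc g eta - eta) p) (at p within disc)"
  shows "tau g = F (1, 0) - F (0, 0)"
proof -
  have gamma: "gamma = linepath (0, 0) (1, 0)"
    by (auto simp: gamma_def linepath_def)
  have "path_image gamma \<subseteq> disc"
    unfolding gamma path_image_linepath disc_cball
    by (intro closed_segment_subset) (auto simp: norm_Pair)
  then have "has_line_integral (pullback1 disc g eta - eta) (F (1, 0) - F (0, 0)) gamma"
    using has_line_integral_potential[of disc F "pullback1 disc g eta - eta" gamma] F
    by (simp add: gamma)
  then show ?thesis
    using g by (simp add: tau_def line_integral_def has_line_integral_def integral_unique)
qed

text \<open>Since \<open>(g h)\<^sup>*\<eta> - \<eta> = h\<^sup>*(g\<^sup>*\<eta> - \<eta>) + (h\<^sup>*\<eta> - \<eta>)\<close>, the potentials add up after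
  composing the one of \<open>g\<close> with \<open>h\<close>.\<close>

lemma potential_mult:
  assumes g: "g \<in> carrier Symp" and h: "h \<in> carrier Symp" and p: "p \<in> disc"
    and F: "\<And>p. p \<in> disc \<Longrightarrow> (F has_derivative (pullback1 disc g \<alpha> - \<alpha>) p) (at p within disc)"
    and K: "\<And>p. p \<in> disc \<Longrightarrow> (K has_derivative (pullback1 disc h \<alpha> - \<alpha>) p) (at p within disc)"
  shows "((\<lambda>p. F (h p) + K p) has_derivative (pullback1 disc (g \<otimes>\<^bsub>Symp\<^esub> h) \<alpha> - \<alpha>) p) (at p within disc)"
proof -
  have B: "g \<in> Bij disc" "h \<in> Bij disc" and sm: "smooth_on disc g" "smooth_on disc h"
    using g h by (auto simp: Symp_def Diff_def)
  have him: "h ` disc \<subseteq> disc" using Diff_disc_mem h by (auto simp: Symp_def)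
  have gh: "(g \<otimes>\<^bsub>Symp\<^esub> h) x = g (h x)" if "x \<in> disc" for x
    using B that by (simp add: Symp_def BijGroup_def compose_def)
  let ?D = "frechet_derivative h (at p within disc)"
  have "(F has_derivative (pullback1 disc g \<alpha> - \<alpha>) (h p)) (at (h p) within h ` disc)"
    by (rule has_derivative_subset[OF F him]) (use him p in auto)
  then have "((\<lambda>p. F (h p)) has_derivative (\<lambda>v. (pullback1 disc g \<alpha> - \<alpha>) (h p) (?D v))) (at p within disc)"
    using diff_chain_within[OF smooth_on_has_derivative[OF sm(2) p], of F] unfolding o_def by blast
  \<comment> \<open>The term \<open>- \<alpha>\<close> of the first form, evaluated at
    \<open>h p\<close> on the image of \<open>v\<close> under the derivative of \<open>h\<close>,
    cancels against the pullback of \<alpha> by \<open>h\<close> in the second.\<close>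
  from has_derivative_add[OF this K[OF p]] show ?thesis
    by (rule has_derivative_eq_rhs)
       (simp add: fun_eq_iff pullback1_def gh[OF p] disc_derivative_compose[OF sm him p gh])
qed

theorem mainTheorem3:
  shows "- coboundary1 Symp0 tau = cochain_pullback2 Symp0 id (ILM_cocycle eta (1, 0))
    \<and> cochain_pullback2 Symp0 id (ILM_cocycle eta (1, 0)) \<in> cochains2 Symp0"
proof
  show "- coboundary1 Symp0 tau = cochain_pullback2 Symp0 id (ILM_cocycle eta (1, 0))"
  proof (intro ext)
    fix g h
    show "(- coboundary1 Symp0 tau) g h = cochain_pullback2 Symp0 id (ILM_cocycle eta (1, 0)) g h"
    proof (cases "g \<in> carrier Symp0 \<and> h \<in> carrier Symp0")
      \<comment> \<open>Outside the group both cochains take the default value 0.\<close>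
      case False
      then show ?thesis by (auto simp: coboundary1_def cochain_pullback2_def)
    next
      case True
      then have g: "g \<in> carrier Symp" and h: "h \<in> carrier Symp" and h0: "h (0, 0) = (0, 0)"
        by (auto simp: Symp0_def)
      have gh: "g \<otimes>\<^bsub>Symp\<^esub> h \<in> carrier Symp0"
        using True Symp0_subgroup by (auto intro: subgroup.m_closed)
      obtain F where F: "\<And>p. p \<in> disc \<Longrightarrow> (F has_derivative (pullback1 disc g eta - eta) p) (at p within disc)"
        by (rule Symp_potential[OF g]) blast
      obtain K where K: "\<And>p. p \<in> disc \<Longrightarrow> (K has_derivative (pullback1 disc h eta - eta) p) (at p within disc)"
        by (rule Symp_potential[OF h]) blast
      \<comment> \<open>The potential of the product is the sum \<open>F (h p) + K p\<close>, so no
        line integral along the image of \<open>gamma\<close> under \<open>h\<close> has to be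
        computed.\<close>
      have "tau (g \<otimes>\<^bsub>Symp\<^esub> h) = (F (h (1, 0)) + K (1, 0)) - (F (h (0, 0)) + K (0, 0))"
        by (rule tau_potential[OF gh potential_mult[OF g h _ F K]])
      moreover have "ILM_cocycle eta (1, 0) g h = F (h (1, 0)) - F (1, 0)"
        by (rule ILM_cocycle_potential[OF g h _ F]) (simp add: disc_def)
      moreover have "tau g = F (1, 0) - F (0, 0)" "tau h = K (1, 0) - K (0, 0)"
        using tau_potential[OF _ F] tau_potential[OF _ K] True by simp_all
      \<comment> \<open>The coboundary multiplies in \<open>Symp0\<close>, which differs from
        \<open>Symp\<close> only in its carrier.\<close>
      moreover have "g \<otimes>\<^bsub>Symp0\<^esub> h = g \<otimes>\<^bsub>Symp\<^esub> h"
        by (simp add: Symp0_def)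
      ultimately show ?thesis
        using True h0 by (simp add: coboundary1_def cochain_pullback2_def)
    qed
  qed
  show "cochain_pullback2 Symp0 id (ILM_cocycle eta (1, 0)) \<in> cochains2 Symp0"
    by (auto simp: cochains2_def cochain_pullback2_def)
qed

end
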